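(* Let $p=p(n)\in[0,1]$ and $d=(n-2)p^2$, and suppose $d\le 1/2$. Then $\tau(G)\sim\nu(G)$ with high probability, where $G=G_{n,p}$; that is, for every $\varepsilon>0$, $\Pr\big(\tau(G)\le(1+\varepsilon)\nu(G)\big)\to 1$ as $n\to\infty$.
   Context: $G_{n,p}$ is the binomial random graph on vertex set $[n]$ in which each of the $\binom n2$ possible edges is present independently with probability $p$. For a finite graph $H$, $\nu(H)$ is the maximum number of pairwise edge-disjoint triangles in $H$, and $\tau(H)$ is the minimum size of a set $F$ of edges of $H$ such that every triangle of $H$ contains an edge of $F$ (note $\tau(H)\ge\nu(H)$ always). *)

theory Defs
  imports "HOL-Probability.Probability"
begin

(* A simple graph is represented by its edge set, each edge being a two-element set of
   vertices; isolated vertices play no role for triangles. *)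

definition complete_edges :: "nat \<Rightarrow> nat set set" where
  "complete_edges n = {e. e \<subseteq> {1..n} \<and> card e = 2}"

(* The pmf on edge sets of graphs on the vertex set {1..n}. Note that bernoulli_pmf clips
   its parameter to the unit interval, so p should be assumed to lie there. *)
definition gnp :: "nat \<Rightarrow> real \<Rightarrow> nat set set pmf" where
  "gnp n p = map_pmf (\<lambda>f. {e \<in> complete_edges n. f e})
               (Pi_pmf (complete_edges n) False (\<lambda>_. bernoulli_pmf p))"

(* A triangle is identified with the set of its three edges. *)
definition triangles :: "'a set set \<Rightarrow> 'a set set set" where
  "triangles E = {{{x, y}, {y, z}, {x, z}} | x y z.
     x \<noteq> y \<and> y \<noteq> z \<and> x \<noteq> z \<and> {x, y} \<in> E \<and> {y, z} \<in> E \<and> {x, z} \<in> E}"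

(* Max and Min below are only meaningful for finite E. *)

definition triangle_packing_number :: "'a set set \<Rightarrow> nat" ("\<nu>") where
  "\<nu> E = Max {card P | P. P \<subseteq> triangles E \<and> pairwise disjnt P}"

definition triangle_cover_number :: "'a set set \<Rightarrow> nat" ("\<tau>") where
  "\<tau> E = Min {card F | F. F \<subseteq> E \<and> (\<forall>T \<in> triangles E. T \<inter> F \<noteq> {})}"

end

theory Submission
  imports Defs
begin

text \<open>
  If every subfamily of a family of triangles has a leaf, a triangle with at most one edge in
  other members, then greedily removing leaves yields a packing and a cover of the same size. A
  family without leaves contains a strip of triangles, each sharing an edge with the previous one
  and adding a new vertex, together with a chord; so \<open>\<tau> - \<nu>\<close> is at most the number of chorded strips.
  A strip of \<open>k\<close> triangles with a chord has \<open>2 k + 2\<close> edges on \<open>k + 2\<close> vertices, and there are about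
  \<open>2 ^ k * n ^ (k + 2)\<close> of them; their expected number is \<open>O(n\<^sup>3 p\<^sup>4)\<close> as soon as \<open>2 n p\<^sup>2\<close> is bounded away
  from 1. To reach the critical value, first delete each edge with a small constant probability
  \<open>\<delta>\<close>, which destroys in expectation at most the proportion \<open>3 \<delta>\<close> of the triangles. Hence
  \<open>\<tau> - \<nu>\<close> has expectation \<open>o(n\<^sup>3 p\<^sup>3)\<close>. On the other hand, \<open>\<nu>\<close> is of order at least \<open>n\<^sup>3 p\<^sup>3\<close> with high
  probability when this quantity is large, by the second moment method and Turan's theorem; when it
  is bounded, \<open>\<tau> = \<nu>\<close> with high probability by Markov's inequality.
\<close>

section \<open>Packings and covers in set families\<close>

text \<open>Put the leaf \<open>t\<close> into the packing and its possibly shared edge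
  \<open>e\<close> into the cover, then discard every member through \<open>e\<close>. A remaining
  member could meet \<open>t\<close> only in \<open>e\<close>, so it is disjoint from
  \<open>t\<close>, and both sides grow by one.\<close>

lemma packing_cover_of_leaves:
  fixes S :: "'a set set"
  assumes "finite S"
    and "\<And>R. R \<subseteq> S \<Longrightarrow> R \<noteq> {} \<Longrightarrow> \<exists>t\<in>R. \<exists>e\<in>t. \<forall>u\<in>R - {t}. t \<inter> u \<subseteq> {e}"
  shows "\<exists>P F. P \<subseteq> S \<and> pairwise disjnt P \<and> F \<subseteq> \<Union>S \<and> finite F \<and>
    (\<forall>t\<in>S. t \<inter> F \<noteq> {}) \<and> card F \<le> card P"
  using assms
proof (induction S rule: finite_psubset_induct)
  case (psubset S)
  show ?case
  proof (cases "S = {}")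
    case True
    then show ?thesis by (intro exI[of _ "{}"]) auto
  next
    case False
    then obtain t e where te: "t \<in> S" "e \<in> t" "\<forall>u\<in>S - {t}. t \<inter> u \<subseteq> {e}"
      using psubset.prems[of S] by auto
    define S' where "S' = {u \<in> S. e \<notin> u}"
    have S': "S' \<subset> S" using te by (auto simp: S'_def)
    have "\<exists>P F. P \<subseteq> S' \<and> pairwise disjnt P \<and> F \<subseteq> \<Union>S' \<and> finite F \<and>
      (\<forall>t\<in>S'. t \<inter> F \<noteq> {}) \<and> card F \<le> card P"
    proof (rule psubset.IH[OF S'])
      fix R assume "R \<subseteq> S'" "R \<noteq> {}"
      then show "\<exists>t\<in>R. \<exists>e\<in>t. \<forall>u\<in>R - {t}. t \<inter> u \<subseteq> {e}"
        using S' by (intro psubset.prems) auto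
    qed
    then obtain P F where PF: "P \<subseteq> S'" "pairwise disjnt P" "F \<subseteq> \<Union>S'" "finite F"
      "\<forall>t\<in>S'. t \<inter> F \<noteq> {}" "card F \<le> card P"
      by metis
    have "finite P" using PF(1) \<open>finite S\<close> by (auto simp: S'_def intro: finite_subset)
    have "t \<notin> P" using PF(1) te by (auto simp: S'_def)
    have "disjnt t u" if "u \<in> P" for u
    proof -
      have "u \<in> S - {t}" "e \<notin> u" using that PF(1) \<open>t \<notin> P\<close> by (auto simp: S'_def)
      then show ?thesis using te(3) by (auto simp: disjnt_def)
    qed
    then have "pairwise disjnt (insert t P)"
      using PF(2) by (auto simp: pairwise_insert disjnt_sym)
    moreover have "card (insert e F) \<le> card (insert t P)"
      using PF(4,6) \<open>finite P\<close> \<open>t \<notin> P\<close> by (simp add: card_insert_if)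
    moreover have "\<forall>u\<in>S. u \<inter> insert e F \<noteq> {}"
      using PF(5) by (auto simp: S'_def)
    moreover have "insert t P \<subseteq> S" "insert e F \<subseteq> \<Union>S" "finite (insert e F)"
      using PF te by (auto simp: S'_def)
    ultimately show ?thesis
      by (intro exI[of _ "insert t P"] exI[of _ "insert e F"] conjI)
  qed
qed

text \<open>Turan's theorem up to a factor 4: take a maximal packing among the members that meet
  at most twice the average number of members.\<close>

lemma packing_ge_card_power2_div_intersecting_pairs:
  fixes N :: "'a set set"
  assumes "finite N" "{} \<notin> N"
  shows "\<exists>P\<subseteq>N. pairwise disjnt P \<and>
    (card N)\<^sup>2 \<le> 4 * card P * card {(t, u). t \<in> N \<and> u \<in> N \<and> \<not> disjnt t u}"
proof -
  define deg where "deg t = card {u \<in> N. \<not> disjnt t u}" for t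
  define Q where "Q = card {(t, u). t \<in> N \<and> u \<in> N \<and> \<not> disjnt t u}"
  have "{(t, u). t \<in> N \<and> u \<in> N \<and> \<not> disjnt t u} = (SIGMA t:N. {u \<in> N. \<not> disjnt t u})"
    by auto
  then have Q: "Q = (\<Sum>t\<in>N. deg t)"
    unfolding Q_def deg_def using assms(1) by (simp add: card_SigmaI)
  define L where "L = {t \<in> N. deg t * card N \<le> 2 * Q}"
  have L: "L \<subseteq> N" "finite L" using assms(1) by (auto simp: L_def)
  \<comment> \<open>Markov's inequality for degrees: members outside \<open>L\<close> exceed twice
    the average, so they form at most half of \<open>N\<close>.\<close>
  have "card N \<le> 2 * card L"
  proof (cases "N = {}")
    case False
    \<comment> \<open>A nonempty set meets itself; hence \<open>Q > 0\<close>, which permits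
      cancelling \<open>Q\<close> below.\<close>
    have "deg t \<ge> 1" if "t \<in> N" for t
    proof -
      have "t \<in> {u \<in> N. \<not> disjnt t u}" using that assms(2) by (auto simp: disjnt_def)
      then have "{u \<in> N. \<not> disjnt t u} \<noteq> {}" by blast
      then show ?thesis unfolding deg_def using assms(1) by (simp add: Suc_le_eq card_gt_0_iff)
    qed
    then have "0 < (\<Sum>t\<in>N. deg t)"
      using False assms(1) by (intro sum_pos) (auto simp: Suc_le_eq)
    then have "Q > 0" unfolding Q .
    have "2 * Q * card (N - L) = (\<Sum>t\<in>N - L. 2 * Q)" by simp
    also have "\<dots> \<le> (\<Sum>t\<in>N - L. deg t * card N)"
      by (intro sum_mono) (auto simp: L_def)
    also have "\<dots> \<le> (\<Sum>t\<in>N. deg t * card N)"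
      using assms(1) by (intro sum_mono2) auto
    also have "\<dots> = Q * card N" by (simp add: Q sum_distrib_right)
    finally have "2 * card (N - L) \<le> card N" using \<open>Q > 0\<close> by simp
    moreover have "card (N - L) = card N - card L" using L by (simp add: card_Diff_subset)
    moreover have "card L \<le> card N" using L assms(1) by (simp add: card_mono)
    ultimately show ?thesis by linarith
  qed simp
  have "finite {P. P \<subseteq> L \<and> pairwise disjnt P}"
    using L(2) by simp
  moreover have "{} \<in> {P. P \<subseteq> L \<and> pairwise disjnt P}" by simp
  ultimately obtain P where "P \<in> {P. P \<subseteq> L \<and> pairwise disjnt P}"
    and max': "\<forall>P'\<in>{P. P \<subseteq> L \<and> pairwise disjnt P}. P \<subseteq> P' \<longrightarrow> P = P'"
    using finite_has_maximal[of "{P. P \<subseteq> L \<and> pairwise disjnt P}"] by blast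
  then have P: "P \<subseteq> L" "pairwise disjnt P" by simp_all
  \<comment> \<open>A member of \<open>L\<close> disjoint from all of \<open>P\<close> would by
    maximality already lie in \<open>P\<close>, and so be disjoint from itself. The degrees of
    \<open>P\<close> therefore account for all of \<open>L\<close>.\<close>
  have "L \<subseteq> (\<Union>p\<in>P. {u \<in> N. \<not> disjnt p u})"
  proof
    fix u assume u: "u \<in> L"
    show "u \<in> (\<Union>p\<in>P. {u \<in> N. \<not> disjnt p u})"
    proof (rule ccontr)
      assume "\<not> ?thesis"
      then have *: "\<forall>p\<in>P. disjnt p u" using u L by auto
      then have "pairwise disjnt (insert u P)"
        using P(2) by (auto simp: pairwise_insert disjnt_sym)
      then have "P = insert u P" using max' u P(1) by blast
      then have "disjnt u u" using * by blast
      then show False using u L assms(2) by (auto simp: disjnt_def)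
    qed
  qed
  then have "card L \<le> card (\<Union>p\<in>P. {u \<in> N. \<not> disjnt p u})"
    using assms(1) L(2) P(1) by (intro card_mono) (auto intro: finite_subset)
  also have "\<dots> \<le> (\<Sum>p\<in>P. deg p)"
    unfolding deg_def using P(1) L(2) by (intro card_UN_le) (auto intro: finite_subset)
  finally have "card L * card N \<le> (\<Sum>p\<in>P. deg p * card N)"
    by (simp add: sum_distrib_right[symmetric])
  also have "\<dots> \<le> (\<Sum>p\<in>P. 2 * Q)" using P(1) by (intro sum_mono) (auto simp: L_def)
  finally have "card L * card N \<le> card P * (2 * Q)" by simp
  moreover have "(card N)\<^sup>2 \<le> 2 * card L * card N"
    using \<open>card N \<le> 2 * card L\<close> by (simp add: power2_eq_square)
  ultimately have "(card N)\<^sup>2 \<le> 4 * card P * Q" by linarith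
  then show ?thesis using P(1,2) L unfolding Q_def by blast
qed

section \<open>Triangles\<close>

definition tri :: "'a \<Rightarrow> 'a \<Rightarrow> 'a \<Rightarrow> 'a set set" where
  "tri x y z = {{x, y}, {y, z}, {x, z}}"

lemma triangles_eq:
  "triangles E = {tri x y z | x y z. x \<noteq> y \<and> y \<noteq> z \<and> x \<noteq> z \<and> tri x y z \<subseteq> E}"
  unfolding triangles_def tri_def by simp

lemma tri_perm: "tri x y z = tri y x z" "tri x y z = tri x z y"
  by (auto simp: tri_def insert_commute)

lemma tri_cong: "{x, y} = {a, b} \<Longrightarrow> tri x y z = tri a b z"
  by (metis doubleton_eq_iff tri_perm(1))

lemma card_tri: "x \<noteq> y \<Longrightarrow> y \<noteq> z \<Longrightarrow> x \<noteq> z \<Longrightarrow> card (tri x y z) = 3"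
  by (auto simp: tri_def card_insert_if doubleton_eq_iff)

lemma card_triangle: "t \<in> triangles E \<Longrightarrow> card t = 3"
  by (auto simp: triangles_eq card_tri)

lemma triangles_subset: "t \<in> triangles E \<Longrightarrow> t \<subseteq> E"
  by (auto simp: triangles_eq)

lemma triangles_iff: "E \<subseteq> E' \<Longrightarrow> t \<in> triangles E \<longleftrightarrow> t \<in> triangles E' \<and> t \<subseteq> E"
  unfolding triangles_eq by blast

lemma finite_triangles: "finite E \<Longrightarrow> finite (triangles E)"
  by (rule finite_subset[of _ "Pow E"]) (auto dest: triangles_subset)

lemma triangle_eq_tri:
  assumes "t \<in> triangles E" "{x, y} \<in> t"
  obtains z where "t = tri x y z" "z \<noteq> x" "z \<noteq> y" "x \<noteq> y"
proof -
  obtain a b c where abc: "t = tri a b c" "a \<noteq> b" "b \<noteq> c" "a \<noteq> c"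
    using assms(1) by (auto simp: triangles_eq)
  then have "{x, y} = {a, b} \<or> {x, y} = {b, c} \<or> {x, y} = {a, c}"
    using assms(2) by (auto simp: tri_def)
  then show thesis
  proof (elim disjE)
    assume "{x, y} = {a, b}"
    then show thesis using that[of c] abc tri_cong[of x y a b c] by (auto simp: doubleton_eq_iff)
  next
    assume "{x, y} = {b, c}"
    moreover have "tri a b c = tri b c a" by (metis tri_perm)
    ultimately show thesis
      using that[of a] abc tri_cong[of x y b c a] by (auto simp: doubleton_eq_iff)
  next
    assume "{x, y} = {a, c}"
    moreover have "tri a b c = tri a c b" by (rule tri_perm)
    ultimately show thesis
      using that[of b] abc tri_cong[of x y a c b] by (auto simp: doubleton_eq_iff)
  qed
qed

lemma triangle_edge:
  assumes "t \<in> triangles E" "e \<in> t"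
  obtains x y where "e = {x, y}"
  using assms by (auto simp: triangles_eq tri_def)

lemma finite_packing_cards:
  "finite E \<Longrightarrow> finite {card P | P. P \<subseteq> triangles E \<and> pairwise disjnt P}"
  using finite_triangles[of E] by (simp add: finite_image_set)

lemma card_le_packing_number:
  assumes "finite E" "P \<subseteq> triangles E" "pairwise disjnt P"
  shows "card P \<le> \<nu> E"
  unfolding triangle_packing_number_def
  using finite_packing_cards[OF assms(1)] assms by (intro Max_ge) auto

lemma cover_number_le_card:
  assumes "finite E" "F \<subseteq> E" "\<And>t. t \<in> triangles E \<Longrightarrow> t \<inter> F \<noteq> {}"
  shows "\<tau> E \<le> card F"
  unfolding triangle_cover_number_def
  using assms by (intro Min_le) (auto simp: finite_image_set)

section \<open>Strips of triangles\<close>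

text \<open>The strip coded by \<open>a\<close>, \<open>b\<close> and \<open>l\<close> is grown from the edge \<open>ab\<close>. It is read from the end of the
  list \<open>l\<close>: each entry is a vertex that is joined to both ends of the current open edge, together
  with a bit that says which of the two edges at the new vertex is the next open edge.\<close>

primrec open_edge :: "'a \<Rightarrow> 'a \<Rightarrow> ('a \<times> bool) list \<Rightarrow> 'a \<times> 'a" where
  "open_edge a b [] = (a, b)"
| "open_edge a b (c # l) =
    (if snd c then fst (open_edge a b l) else snd (open_edge a b l), fst c)"

primrec strip_edges :: "'a \<Rightarrow> 'a \<Rightarrow> ('a \<times> bool) list \<Rightarrow> 'a set set" where
  "strip_edges a b [] = {{a, b}}"
| "strip_edges a b (c # l) =
    {{fst (open_edge a b l), fst c}, {snd (open_edge a b l), fst c}} \<union> strip_edges a b l"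

primrec strip_triangles :: "'a \<Rightarrow> 'a \<Rightarrow> ('a \<times> bool) list \<Rightarrow> 'a set set set" where
  "strip_triangles a b [] = {}"
| "strip_triangles a b (c # l) =
    insert (tri (fst (open_edge a b l)) (snd (open_edge a b l)) (fst c)) (strip_triangles a b l)"

text \<open>A list rather than a set: distinctness says that each step adds a new vertex, and the
  far end of a chord can be coded by its index.\<close>

definition strip_vertices :: "'a \<Rightarrow> 'a \<Rightarrow> ('a \<times> bool) list \<Rightarrow> 'a list" where
  "strip_vertices a b l = a # b # map fst l"

lemma open_edge_vertices:
  "fst (open_edge a b l) \<in> set (strip_vertices a b l)"
  "snd (open_edge a b l) \<in> set (strip_vertices a b l)"
  by (induction l) (auto simp: strip_vertices_def)

lemma distinct_Cons_strip_vertices: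
  "distinct (strip_vertices a b (c # l)) \<longleftrightarrow>
    fst c \<notin> set (strip_vertices a b l) \<and> distinct (strip_vertices a b l)"
  by (auto simp: strip_vertices_def)

lemma open_edge_distinct:
  assumes "distinct (strip_vertices a b l)"
  shows "fst (open_edge a b l) \<noteq> snd (open_edge a b l)"
proof (cases l)
  case Nil
  then show ?thesis using assms by (simp add: strip_vertices_def)
next
  case (Cons c l')
  then show ?thesis
    using assms open_edge_vertices[of a b l'] by (auto simp: distinct_Cons_strip_vertices)
qed

lemma strip_edge_subset: "e \<in> strip_edges a b l \<Longrightarrow> e \<subseteq> set (strip_vertices a b l)"
proof (induction l)
  case (Cons c l)
  then show ?case using open_edge_vertices[of a b l] by (auto simp: strip_vertices_def)
qed (simp add: strip_vertices_def)

lemma finite_strip_edges: "finite (strip_edges a b l)"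
  by (induction l) auto

lemma card_strip_edge:
  "distinct (strip_vertices a b l) \<Longrightarrow> e \<in> strip_edges a b l \<Longrightarrow> card e = 2"
proof (induction l)
  case (Cons c l)
  then have "fst (open_edge a b l) \<noteq> fst c" "snd (open_edge a b l) \<noteq> fst c"
    using open_edge_vertices[of a b l] by (auto simp: distinct_Cons_strip_vertices)
  with Cons show ?case by (auto simp: distinct_Cons_strip_vertices)
qed (simp add: strip_vertices_def)

text \<open>Each new vertex lies in no earlier edge and is joined to two different ends, so every
  entry adds exactly two edges to the initial one.\<close>

lemma card_strip_edges:
  "distinct (strip_vertices a b l) \<Longrightarrow> card (strip_edges a b l) = 2 * length l + 1"
proof (induction l)
  case (Cons c l)
  define u w where "u = fst (open_edge a b l)" and "w = snd (open_edge a b l)"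
  have d: "fst c \<notin> set (strip_vertices a b l)" "distinct (strip_vertices a b l)"
    using Cons.prems by (auto simp: distinct_Cons_strip_vertices)
  then have "{u, fst c} \<notin> strip_edges a b l" "{w, fst c} \<notin> strip_edges a b l" "u \<noteq> w"
    using strip_edge_subset[of _ a b l] open_edge_distinct[OF d(2)] by (auto simp: u_def w_def)
  then show ?case
    using Cons.IH[OF d(2)] finite_strip_edges[of a b l]
    by (auto simp: doubleton_eq_iff card_insert_if simp flip: u_def w_def)
qed simp

text \<open>The empty list has to be excluded: it has the edge \<open>ab\<close> but no
  triangle.\<close>

lemma strip_edges_subset_triangles:
  "l \<noteq> [] \<Longrightarrow> strip_edges a b l \<subseteq> \<Union> (strip_triangles a b l)"
proof (induction l)
  case (Cons c l)
  show ?case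
  proof (cases "l = []")
    case False
    then show ?thesis using Cons.IH by (auto simp: tri_def)
  qed (auto simp: tri_def)
qed simp

text \<open>In a family without leaves the last vertex of a longest strip must be joined to an older
  vertex by an edge outside the strip, since otherwise the strip could be prolonged.\<close>

lemma leaf_or_strip_with_chord:
  fixes E :: "'a set set"
  assumes "finite (\<Union>E)" "R \<subseteq> triangles E" "R \<noteq> {}"
    and no_leaf: "\<And>t e. t \<in> R \<Longrightarrow> e \<in> t \<Longrightarrow> \<exists>u\<in>R - {t}. \<not> t \<inter> u \<subseteq> {e}"
  obtains a b c l v where "distinct (strip_vertices a b (c # l))"
    "v \<in> set (strip_vertices a b (c # l))"
    "{fst c, v} \<notin> strip_edges a b (c # l)" "fst c \<noteq> v"
    "insert {fst c, v} (strip_edges a b (c # l)) \<subseteq> E"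
    "tri (fst (open_edge a b l)) (snd (open_edge a b l)) (fst c) \<in> R"
proof -
  define good where "good = (\<lambda>(a, b, l). l \<noteq> [] \<and> distinct (strip_vertices a b l) \<and>
    strip_triangles a b l \<subseteq> R)"
  have sub: "strip_edges a b l \<subseteq> E" if "good (a, b, l)" for a b l
    using that strip_edges_subset_triangles[of l a b] assms(2) triangles_subset[of _ E]
    by (fastforce simp: good_def)
  have bound: "length l \<le> card (\<Union>E)" if "good (a, b, l)" for a b l
  proof -
    have "fst ` set l \<subseteq> \<Union> (strip_edges a b l)" by (induction l) auto
    then have "fst ` set l \<subseteq> \<Union>E" using sub[OF that] by auto
    then have "card (set (map fst l)) \<le> card (\<Union>E)" using assms(1) by (simp add: card_mono)
    moreover have "distinct (map fst l)" using that by (simp add: good_def strip_vertices_def)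
    ultimately show ?thesis by (metis distinct_card length_map)
  qed
  obtain t where "t \<in> R" using assms(3) by auto
  then obtain x y z where "t = tri x y z" "x \<noteq> y" "y \<noteq> z" "x \<noteq> z"
    using assms(2) by (auto simp: triangles_eq)
  then have "good (x, y, [(z, True)])"
    using \<open>t \<in> R\<close> by (auto simp: good_def strip_vertices_def)
  \<comment> \<open>The vertices of a good strip are distinct vertices of \<open>E\<close>, so
    lengths are bounded and a longest good strip exists.\<close>
  then have "\<exists>s. good s \<and> (\<forall>s'. good s' \<longrightarrow> length (snd (snd s')) \<le> length (snd (snd s)))"
    using bound by (intro ex_has_greatest_nat[where b = "Suc (card (\<Union>E))"]) (auto simp: less_Suc_eq_le)
  then obtain a b l0 where l0: "good (a, b, l0)"
    and max: "\<And>a' b' l'. good (a', b', l') \<Longrightarrow> length l' \<le> length l0"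
    by auto
  then obtain c0 l where l0_eq: "l0 = c0 # l" by (cases l0) (auto simp: good_def)
  define u w c where "u = fst (open_edge a b l)" and "w = snd (open_edge a b l)" and "c = fst c0"
  have T: "tri u w c \<in> R"
    using l0 by (auto simp: l0_eq good_def u_def w_def c_def)
  have d: "c \<notin> set (strip_vertices a b l)" "distinct (strip_vertices a b l)"
    using l0 by (auto simp: l0_eq good_def distinct_Cons_strip_vertices c_def)
  have uw: "u \<noteq> w" "u \<noteq> c" "w \<noteq> c"
    using open_edge_distinct[OF d(2)] open_edge_vertices[of a b l] d(1) by (auto simp: u_def w_def)
  \<comment> \<open>Absence of a leaf is applied to the edge through which the last triangle was
    entered, so \<open>T'\<close> shares one of the two edges at \<open>c\<close>.\<close>
  obtain T' where T': "T' \<in> R" "T' \<noteq> tri u w c" "\<not> tri u w c \<inter> T' \<subseteq> {{u, w}}"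
    using no_leaf[OF T, of "{u, w}"] by (auto simp: tri_def)
  then have "{u, c} \<in> T' \<or> {w, c} \<in> T'" unfolding tri_def by blast
  then obtain s where s: "{if s then u else w, c} \<in> T'"
    by (elim disjE) (auto intro: that[of True] that[of False])
  define x x' where "x = (if s then u else w)" and "x' = (if s then w else u)"
  have x: "{x, c} \<in> T'" "{x, x'} = {u, w}" "x = (if s then u else w)"
    using s by (auto simp: x_def x'_def)
  obtain v where v: "T' = tri x c v" "v \<noteq> x" "v \<noteq> c"
    using triangle_eq_tri[OF _ x(1)] T'(1) assms(2) by (metis subsetD)
  \<comment> \<open>The bit of the newest entry affects neither vertices nor triangles. Resetting it
    to \<open>s\<close> keeps the strip longest and makes the edge shared with \<open>T'\<close> the
    open edge.\<close>
  have good': "good (a, b, (c, s) # l)"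
    using l0 by (auto simp: l0_eq good_def strip_vertices_def c_def)
  have oe: "open_edge a b ((c, s) # l) = (x, c)"
    using x(3) by (simp add: u_def w_def)
  \<comment> \<open>With a new vertex \<open>v\<close>, appending \<open>T'\<close> would give a
    longer good strip.\<close>
  have "v \<in> set (strip_vertices a b ((c, s) # l))"
  proof (rule ccontr)
    assume "v \<notin> set (strip_vertices a b ((c, s) # l))"
    then have "good (a, b, (v, True) # (c, s) # l)"
      using good' oe T' v by (auto simp: good_def strip_vertices_def)
    from max[OF this] show False by (simp add: l0_eq)
  qed
  \<comment> \<open>The only strip edges at \<open>c\<close> lead to \<open>u\<close> and
    \<open>w\<close>. As \<open>v\<close> differs from \<open>x\<close>, it would be the other of
    these two, and \<open>T'\<close> would be the last triangle itself.\<close>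
  moreover have "{c, v} \<notin> strip_edges a b ((c, s) # l)"
  proof
    assume "{c, v} \<in> strip_edges a b ((c, s) # l)"
    then have "v = u \<or> v = w"
      using d(1) strip_edge_subset[of "{c, v}" a b l] v(3)
      by (auto simp: doubleton_eq_iff u_def w_def)
    with v x(2) have "{u, w} = {x, v}" by (auto simp: doubleton_eq_iff)
    with v(1) have "T' = tri u w c" by (metis tri_cong tri_perm(2))
    then show False using T' by simp
  qed
  moreover have "{c, v} \<in> E"
    using T'(1) v(1) assms(2) triangles_subset[of T' E] by (auto simp: tri_def)
  ultimately show thesis
    using that[of a b "(c, s)" l v] good' sub[OF good'] v(3) T
    by (simp add: good_def u_def w_def)
qed

section \<open>Bounding \<tau> - \<nu> by a count of deleted triangles and chorded strips\<close>

text \<open>Peeling leaves handles \<open>R\<close> at a cost of at most \<open>\<nu> E\<close>;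
  each triangle outside \<open>R\<close> is covered by one arbitrary edge of its own.\<close>

lemma cover_number_le_of_leaves:
  assumes "finite E" "R \<subseteq> triangles E"
    and "\<And>R'. R' \<subseteq> R \<Longrightarrow> R' \<noteq> {} \<Longrightarrow> \<exists>t\<in>R'. \<exists>e\<in>t. \<forall>u\<in>R' - {t}. t \<inter> u \<subseteq> {e}"
  shows "\<tau> E \<le> \<nu> E + card (triangles E - R)"
proof -
  have fin: "finite (triangles E)" using assms(1) by (rule finite_triangles)
  have "\<exists>P F. P \<subseteq> R \<and> pairwise disjnt P \<and> F \<subseteq> \<Union>R \<and> finite F \<and>
      (\<forall>t\<in>R. t \<inter> F \<noteq> {}) \<and> card F \<le> card P"
    using assms(2,3) fin by (intro packing_cover_of_leaves) (auto intro: finite_subset)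
  then obtain P F where PF: "P \<subseteq> R" "pairwise disjnt P" "F \<subseteq> \<Union>R" "finite F"
      "\<forall>t\<in>R. t \<inter> F \<noteq> {}" "card F \<le> card P"
    by metis
  define pick where "pick t = (SOME e. e \<in> t)" for t :: "'a set set"
  have pick: "pick t \<in> t" if "t \<in> triangles E" for t
  proof -
    have "t \<noteq> {}" using card_triangle[OF that] by auto
    then show ?thesis unfolding pick_def by (simp add: some_in_eq)
  qed
  define F' where "F' = F \<union> pick ` (triangles E - R)"
  have "\<tau> E \<le> card F'"
  proof (rule cover_number_le_card[OF assms(1)])
    show "F' \<subseteq> E"
      using PF(3) assms(2) pick triangles_subset by (fastforce simp: F'_def)
    show "t \<inter> F' \<noteq> {}" if "t \<in> triangles E" for t
      using that PF(5) pick[OF that] by (cases "t \<in> R") (auto simp: F'_def)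
  qed
  also have "\<dots> \<le> card F + card (pick ` (triangles E - R))"
    unfolding F'_def by (rule card_Un_le)
  also have "card (pick ` (triangles E - R)) \<le> card (triangles E - R)"
    using fin by (intro card_image_le) auto
  also have "card F \<le> \<nu> E"
    using PF(1,2,6) card_le_packing_number[OF assms(1), of P] assms(2) by fastforce
  finally show ?thesis by simp
qed

text \<open>A code \<open>(a, b, l, i)\<close> stands for the strip \<open>(a, b, l)\<close> together with the chord from its last
  vertex to its \<open>i\<close>-th vertex.\<close>

definition chorded_strips :: "nat \<Rightarrow> nat \<Rightarrow> (nat \<times> nat \<times> (nat \<times> bool) list \<times> nat) set" where
  "chorded_strips n k = {(a, b, l, i). a \<in> {1..n} \<and> b \<in> {1..n} \<and> set l \<subseteq> {1..n} \<times> UNIV \<and>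
     length l = k \<and> i < k + 2 \<and> distinct (strip_vertices a b l) \<and>
     {fst (hd l), strip_vertices a b l ! i} \<notin> strip_edges a b l \<and>
     fst (hd l) \<noteq> strip_vertices a b l ! i}"

definition chorded_strip_edges :: "nat \<times> nat \<times> (nat \<times> bool) list \<times> nat \<Rightarrow> nat set set" where
  "chorded_strip_edges = (\<lambda>(a, b, l, i).
     insert {fst (hd l), strip_vertices a b l ! i} (strip_edges a b l))"

text \<open>Codes grow at the head of the list: \<open>hd l\<close> holds the newest vertex and
  \<open>tl l\<close> the strip before it. This is the triangle that gets charged to a chorded
  strip.\<close>

definition last_triangle :: "nat \<times> nat \<times> (nat \<times> bool) list \<times> nat \<Rightarrow> nat set set" where
  "last_triangle = (\<lambda>(a, b, l, i).
     tri (fst (open_edge a b (tl l))) (snd (open_edge a b (tl l))) (fst (hd l)))"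

lemma chorded_strips_subset:
  "chorded_strips n k \<subseteq>
    {1..n} \<times> {1..n} \<times> {l. set l \<subseteq> {1..n} \<times> UNIV \<and> length l = k} \<times> {..<k + 2}"
  by (auto simp: chorded_strips_def)

lemma finite_chorded_strips: "finite (chorded_strips n k)"
  by (rule finite_subset[OF chorded_strips_subset])
    (intro finite_cartesian_product finite_lists_length_eq; simp)

text \<open>The bit doubles the choices for each entry; with two edges per entry this makes
  \<open>2 * n * p\<^sup>2\<close> the growth rate, whence the threshold 1/2 for
  \<open>d\<close>.\<close>

lemma card_chorded_strips: "card (chorded_strips n k) \<le> n\<^sup>2 * (2 * n) ^ k * (k + 2)"
proof -
  have "card (chorded_strips n k) \<le> card ({1..n} \<times> {1..n} \<times>
      {l. set l \<subseteq> {1..n} \<times> (UNIV :: bool set) \<and> length l = k} \<times> {..<k + 2})"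
    by (intro card_mono chorded_strips_subset finite_cartesian_product finite_lists_length_eq) simp_all
  also have "\<dots> = n\<^sup>2 * (2 * n) ^ k * (k + 2)"
    by (simp add: card_cartesian_product card_lists_length_eq power2_eq_square algebra_simps)
  finally show ?thesis .
qed

lemma card_chorded_strip_edges:
  "s \<in> chorded_strips n k \<Longrightarrow> card (chorded_strip_edges s) = 2 * k + 2"
  by (auto simp: chorded_strips_def chorded_strip_edges_def card_strip_edges finite_strip_edges)

lemma finite_complete_edges: "finite (complete_edges n)"
  unfolding complete_edges_def by simp

lemma chorded_strip_edges_subset:
  assumes "s \<in> chorded_strips n k" "k > 0"
  shows "chorded_strip_edges s \<subseteq> complete_edges n"
proof -
  obtain a b l i where s: "s = (a, b, l, i)" by (cases s)
  have ab: "a \<in> {1..n}" "b \<in> {1..n}" "set l \<subseteq> {1..n} \<times> UNIV" "length l = k" "i < k + 2"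
    "distinct (strip_vertices a b l)" "fst (hd l) \<noteq> strip_vertices a b l ! i"
    using assms(1) by (auto simp: s chorded_strips_def)
  have V: "set (strip_vertices a b l) \<subseteq> {1..n}" using ab(1-3) by (auto simp: strip_vertices_def)
  have "l \<noteq> []" using ab(4) assms(2) by auto
  then have "fst (hd l) \<in> set (strip_vertices a b l)" by (auto simp: strip_vertices_def)
  moreover have "strip_vertices a b l ! i \<in> set (strip_vertices a b l)"
    using ab(4,5) by (intro nth_mem) (simp add: strip_vertices_def)
  ultimately have "{fst (hd l), strip_vertices a b l ! i} \<in> complete_edges n"
    using V ab(7) by (auto simp: complete_edges_def)
  moreover have "strip_edges a b l \<subseteq> complete_edges n"
    using strip_edge_subset[of _ a b l] card_strip_edge[OF ab(6)] V
    by (auto simp: complete_edges_def)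
  ultimately show ?thesis by (simp add: s chorded_strip_edges_def)
qed

text \<open>Among the triangles inside \<open>S\<close>, delete the last triangle of every chorded
  strip in \<open>E \<inter> S\<close>. A leafless subfamily of the rest would contain the last
  triangle of such a strip, which is impossible. All other triangles are covered one by one.\<close>

lemma cover_number_le_thinned:
  assumes "E \<subseteq> complete_edges n"
  shows "\<tau> E \<le> \<nu> E + card {t \<in> triangles E. \<not> t \<subseteq> S} +
    (\<Sum>k=1..n. card {s \<in> chorded_strips n k. chorded_strip_edges s \<subseteq> E \<inter> S})"
proof -
  define C where "C k = {s \<in> chorded_strips n k. chorded_strip_edges s \<subseteq> E \<inter> S}" for k
  define B where "B = (\<Union>k\<in>{1..n}. last_triangle ` C k)"
  define R where "R = triangles (E \<inter> S) - B"
  have finC: "finite (C k)" for k unfolding C_def using finite_chorded_strips by simp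
  have "finite E" using assms finite_complete_edges finite_subset by blast
  have EV: "\<Union>E \<subseteq> {1..n}" using assms by (auto simp: complete_edges_def)
  have tri_iff: "t \<in> triangles (E \<inter> S) \<longleftrightarrow> t \<in> triangles E \<and> t \<subseteq> S" for t
    unfolding triangles_iff[OF Int_lower1] using triangles_subset by blast
  have leaf: "\<exists>t\<in>R'. \<exists>e\<in>t. \<forall>u\<in>R' - {t}. t \<inter> u \<subseteq> {e}" if R': "R' \<subseteq> R" "R' \<noteq> {}" for R'
  proof (rule ccontr)
    assume no_leaf: "\<not> ?thesis"
    have h1: "finite (\<Union>(E \<inter> S))" by (rule finite_subset[of _ "{1..n}"]) (use EV in auto)
    have h2: "R' \<subseteq> triangles (E \<inter> S)" using R' by (auto simp: R_def)
    have h3: "\<exists>u\<in>R' - {t}. \<not> t \<inter> u \<subseteq> {e}" if "t \<in> R'" "e \<in> t" for t e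
    proof (rule ccontr)
      assume "\<not> ?thesis"
      then have "\<forall>u\<in>R' - {t}. t \<inter> u \<subseteq> {e}" by blast
      with that have "\<exists>t\<in>R'. \<exists>e\<in>t. \<forall>u\<in>R' - {t}. t \<inter> u \<subseteq> {e}" by (intro bexI)
      with no_leaf show False by (rule notE)
    qed
    obtain a b c l v where s: "distinct (strip_vertices a b (c # l))"
      "v \<in> set (strip_vertices a b (c # l))"
      "{fst c, v} \<notin> strip_edges a b (c # l)" "fst c \<noteq> v"
      "insert {fst c, v} (strip_edges a b (c # l)) \<subseteq> E \<inter> S"
      "tri (fst (open_edge a b l)) (snd (open_edge a b l)) (fst c) \<in> R'"
      by (rule leaf_or_strip_with_chord[OF h1 h2 R'(2) h3])
    obtain i where i: "i < length (strip_vertices a b (c # l))" "strip_vertices a b (c # l) ! i = v"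
      using s(2) unfolding in_set_conv_nth by blast
    have len: "length (strip_vertices a b (c # l)) = length (c # l) + 2"
      by (simp add: strip_vertices_def)
    have V: "set (strip_vertices a b l') \<subseteq> \<Union>(strip_edges a b l')" for l'
      by (induction l') (auto simp: strip_vertices_def)
    have "\<Union>(strip_edges a b (c # l)) \<subseteq> \<Union>E" using s(5) by auto
    with V[of "c # l"] EV have V': "set (strip_vertices a b (c # l)) \<subseteq> {1..n}"
      by (meson order_trans)
    then have "a \<in> {1..n}" "b \<in> {1..n}" "fst ` set (c # l) \<subseteq> {1..n}"
      by (auto simp: strip_vertices_def)
    then have "set (c # l) \<subseteq> {1..n} \<times> UNIV"
      unfolding image_subset_iff by (auto simp: mem_Times_iff)
    \<comment> \<open>A strip of \<open>k\<close> triangles has \<open>k + 2\<close> distinct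
      vertices in \<open>{1..n}\<close>, so summing over \<open>k\<close> up to \<open>n\<close>
      misses no strip.\<close>
    moreover have "length (c # l) \<in> {1..n}"
    proof -
      have "card (set (strip_vertices a b (c # l))) \<le> card {1..n}" using V' by (intro card_mono) auto
      then show ?thesis using distinct_card[OF s(1)] len by simp
    qed
    moreover have "i < length (c # l) + 2" using i(1) len by simp
    ultimately have "(a, b, c # l, i) \<in> chorded_strips n (length (c # l))"
      unfolding chorded_strips_def mem_Collect_eq prod.case list.sel i(2)
      using s(1,3,4) \<open>a \<in> {1..n}\<close> \<open>b \<in> {1..n}\<close> by blast
    moreover have "chorded_strip_edges (a, b, c # l, i) \<subseteq> E \<inter> S"
      unfolding chorded_strip_edges_def prod.case list.sel i(2) by (rule s(5))
    ultimately have "(a, b, c # l, i) \<in> C (length (c # l))"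
      unfolding C_def by blast
    then have "last_triangle (a, b, c # l, i) \<in> B"
      unfolding B_def using \<open>length (c # l) \<in> {1..n}\<close> by blast
    then show False using s(6) R'(1) by (auto simp: last_triangle_def R_def)
  qed
  have "\<tau> E \<le> \<nu> E + card (triangles E - R)"
    using \<open>finite E\<close> leaf by (intro cover_number_le_of_leaves) (auto simp: R_def tri_iff)
  also have "triangles E - R \<subseteq> {t \<in> triangles E. \<not> t \<subseteq> S} \<union> B"
    by (auto simp: R_def tri_iff)
  then have "card (triangles E - R) \<le> card ({t \<in> triangles E. \<not> t \<subseteq> S} \<union> B)"
    using finC finite_triangles[OF \<open>finite E\<close>] by (intro card_mono) (auto simp: B_def)
  also have "\<dots> \<le> card {t \<in> triangles E. \<not> t \<subseteq> S} + card B" by (rule card_Un_le)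
  also have "card B \<le> (\<Sum>k=1..n. card (last_triangle ` C k))"
    unfolding B_def by (rule card_UN_le) simp
  also have "\<dots> \<le> (\<Sum>k=1..n. card (C k))" by (intro sum_mono card_image_le finC)
  finally show ?thesis by (simp add: C_def)
qed

section \<open>Expectations in the binomial random graph\<close>

lemma set_pmf_gnp: "G \<in> set_pmf (gnp n p) \<Longrightarrow> G \<subseteq> complete_edges n"
  by (auto simp: gnp_def)

lemma integrable_gnp: "integrable (measure_pmf (gnp n p)) (f :: nat set set \<Rightarrow> real)"
proof (rule integrable_measure_pmf_finite)
  show "finite (set_pmf (gnp n p))"
    by (rule finite_subset[of _ "Pow (complete_edges n)"])
      (use set_pmf_gnp finite_complete_edges in auto)
qed

lemma prob_gnp_superset:
  assumes "p \<in> {0..1}" "F \<subseteq> complete_edges n"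
  shows "measure_pmf.prob (gnp n p) {G. F \<subseteq> G} = p ^ card F"
proof -
  let ?M = "Pi_pmf (complete_edges n) False (\<lambda>_. bernoulli_pmf p)"
  define B where "B e = (if e \<in> F then {True} else UNIV)" for e
  have fin: "finite (complete_edges n)" by (rule finite_complete_edges)
  have "measure_pmf.prob (gnp n p) {G. F \<subseteq> G} = measure_pmf.prob ?M (Pi (complete_edges n) B)"
    unfolding gnp_def measure_map_pmf
    using assms(2) by (intro arg_cong2[where f = measure] refl) (auto simp: B_def Pi_iff split: if_splits)
  also have "\<dots> = (\<Prod>e\<in>complete_edges n. measure_pmf.prob (bernoulli_pmf p) (B e))"
    using fin by (rule measure_Pi_pmf_Pi)
  also have "\<dots> = (\<Prod>e\<in>complete_edges n. if e \<in> F then p else 1)"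
    using assms(1) by (intro prod.cong refl) (auto simp: B_def measure_pmf_single)
  also have "\<dots> = p ^ card (complete_edges n \<inter> F)"
    using fin by (simp add: prod.If_cases flip: Int_def)
  also have "complete_edges n \<inter> F = F" using assms(2) by auto
  finally show ?thesis .
qed

text \<open>Linearity of expectation in one form for triangles, pairs of triangles and chorded
  strips. It also serves for the set of kept edges, which has the law of \<open>gnp\<close> with
  parameter \<open>1 - \<delta>\<close>.\<close>

lemma expectation_gnp_card_supersets:
  assumes "p \<in> {0..1}" "finite I" "\<And>s. s \<in> I \<Longrightarrow> F s \<subseteq> complete_edges n"
  shows "measure_pmf.expectation (gnp n p) (\<lambda>G. real (card {s \<in> I. F s \<subseteq> G})) =
    (\<Sum>s\<in>I. p ^ card (F s))"
proof -
  have "real (card {s \<in> I. F s \<subseteq> G}) = (\<Sum>s\<in>I. indicator {G. F s \<subseteq> G} G)" for G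
    using assms(2) by (simp add: indicator_def sum.If_cases Int_def)
  then have "measure_pmf.expectation (gnp n p) (\<lambda>G. real (card {s \<in> I. F s \<subseteq> G})) =
      (\<Sum>s\<in>I. measure_pmf.expectation (gnp n p) (indicator {G. F s \<subseteq> G}))"
    by (simp add: Bochner_Integration.integral_sum integrable_gnp)
  also have "\<dots> = (\<Sum>s\<in>I. p ^ card (F s))"
    using assms by (intro sum.cong refl) (simp add: prob_gnp_superset)
  finally show ?thesis .
qed

lemma gnp_Markov:
  assumes "\<And>G. 0 \<le> f G" "c > 0"
  shows "measure_pmf.prob (gnp n p) {G. f G \<ge> c} \<le> measure_pmf.expectation (gnp n p) f / c"
  using integral_Markov_inequality_measure[of "measure_pmf (gnp n p)" f "{}" c] assms
  by (simp add: integrable_gnp)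

text \<open>An upper bound for the mean of the error terms in \<open>cover_number_le_thinned\<close>
  over the random set \<open>S\<close> of kept edges: a triangle is destroyed with probability at
  most \<open>3 * \<delta>\<close>, and a chorded strip survives only if its
  \<open>2 * k + 2\<close> edges are kept.\<close>

definition excess_bound :: "nat \<Rightarrow> real \<Rightarrow> nat set set \<Rightarrow> real" where
  "excess_bound n \<delta> G = 3 * \<delta> * real (card (triangles G)) +
    (\<Sum>k=1..n. (1 - \<delta>) ^ (2 * k + 2) *
      real (card {s \<in> chorded_strips n k. chorded_strip_edges s \<subseteq> G}))"

lemma excess_bound_nonneg: "\<delta> \<in> {0..1} \<Longrightarrow> 0 \<le> excess_bound n \<delta> G"
  unfolding excess_bound_def by (intro add_nonneg_nonneg sum_nonneg mult_nonneg_nonneg) auto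

text \<open>Keep each edge of \<open>G\<close> with probability \<open>1 - \<delta>\<close> and average over the random set of kept edges.\<close>

lemma cover_number_le_excess_bound:
  assumes "G \<subseteq> complete_edges n" "\<delta> \<in> {0..1}"
  shows "real (\<tau> G) \<le> real (\<nu> G) + excess_bound n \<delta> G"
proof -
  let ?E = "measure_pmf.expectation (gnp n (1 - \<delta>))"
  have d: "1 - \<delta> \<in> {0..1}" using assms(2) by auto
  have fin: "finite (triangles G)"
    using assms(1) finite_complete_edges finite_subset finite_triangles by blast
  define K where "K S = {t \<in> triangles G. t \<subseteq> S}" for S
  define I where "I k = {s \<in> chorded_strips n k. chorded_strip_edges s \<subseteq> G}" for k
  \<comment> \<open>Destroyed triangles are counted as all minus surviving ones, because survival is
    an event of the form \<open>t \<subseteq> S\<close>.\<close>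
  have pt: "real (\<tau> G) \<le> real (\<nu> G) + real (card (triangles G)) - real (card (K S)) +
    (\<Sum>k=1..n. real (card {s \<in> I k. chorded_strip_edges s \<subseteq> S}))" for S
  proof -
    have "{t \<in> triangles G. \<not> t \<subseteq> S} = triangles G - K S" by (auto simp: K_def)
    then have "real (card {t \<in> triangles G. \<not> t \<subseteq> S}) = real (card (triangles G)) - real (card (K S))"
      using fin by (simp add: K_def card_Diff_subset of_nat_diff card_mono)
    moreover have "{s \<in> chorded_strips n k. chorded_strip_edges s \<subseteq> G \<inter> S} =
      {s \<in> I k. chorded_strip_edges s \<subseteq> S}" for k by (auto simp: I_def)
    ultimately show ?thesis
      using cover_number_le_thinned[OF assms(1), of S] by (simp flip: of_nat_sum of_nat_add)
  qed
  have "real (\<tau> G) = ?E (\<lambda>S. real (\<tau> G))" by simp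
  also have "\<dots> \<le> ?E (\<lambda>S. real (\<nu> G) + real (card (triangles G)) - real (card (K S)) +
    (\<Sum>k=1..n. real (card {s \<in> I k. chorded_strip_edges s \<subseteq> S})))"
    by (intro integral_mono integrable_gnp pt)
  also have "\<dots> = real (\<nu> G) + real (card (triangles G)) - ?E (\<lambda>S. real (card (K S))) +
    (\<Sum>k=1..n. ?E (\<lambda>S. real (card {s \<in> I k. chorded_strip_edges s \<subseteq> S})))"
    by (simp add: integrable_gnp)
  also have "?E (\<lambda>S. real (card (K S))) = (\<Sum>t\<in>triangles G. (1 - \<delta>) ^ card t)"
    unfolding K_def using assms(1) triangles_subset fin
    by (intro expectation_gnp_card_supersets d) blast+
  also have "\<dots> = (1 - \<delta>) ^ 3 * real (card (triangles G))"
    by (simp add: card_triangle)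
  also have "(\<Sum>k=1..n. ?E (\<lambda>S. real (card {s \<in> I k. chorded_strip_edges s \<subseteq> S}))) =
      (\<Sum>k=1..n. (1 - \<delta>) ^ (2 * k + 2) * real (card (I k)))"
  proof (intro sum.cong refl)
    fix k assume "k \<in> {1..n}"
    have "?E (\<lambda>S. real (card {s \<in> I k. chorded_strip_edges s \<subseteq> S})) =
        (\<Sum>s\<in>I k. (1 - \<delta>) ^ card (chorded_strip_edges s))"
      using assms(1) finite_chorded_strips by (intro expectation_gnp_card_supersets d) (auto simp: I_def)
    also have "\<dots> = (\<Sum>s\<in>I k. (1 - \<delta>) ^ (2 * k + 2))"
      by (intro sum.cong refl) (auto simp: I_def dest!: card_chorded_strip_edges)
    finally show "?E (\<lambda>S. real (card {s \<in> I k. chorded_strip_edges s \<subseteq> S})) =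
      (1 - \<delta>) ^ (2 * k + 2) * real (card (I k))" by simp
  qed
  finally have "real (\<tau> G) \<le> real (\<nu> G) + (1 - (1 - \<delta>) ^ 3) * real (card (triangles G)) +
      (\<Sum>k=1..n. (1 - \<delta>) ^ (2 * k + 2) * real (card (I k)))"
    by (simp add: algebra_simps)
  moreover have "1 - (1 - \<delta>) ^ 3 \<le> 3 * \<delta>"
    using Bernoulli_inequality[of "- \<delta>" 3] assms(2) by simp
  then have "(1 - (1 - \<delta>) ^ 3) * real (card (triangles G)) \<le> 3 * \<delta> * real (card (triangles G))"
    by (intro mult_right_mono) auto
  ultimately show ?thesis unfolding excess_bound_def I_def by linarith
qed

section \<open>Expected numbers of triangles and the expected excess\<close>

lemma expectation_gnp_mono:
  assumes "\<And>G. G \<subseteq> complete_edges n \<Longrightarrow> f G \<le> (g G :: real)"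
  shows "measure_pmf.expectation (gnp n p) f \<le> measure_pmf.expectation (gnp n p) g"
  using assms set_pmf_gnp[of _ n p]
  by (intro integral_mono_AE integrable_gnp) (auto simp: AE_measure_pmf_iff)

lemma triangles_subgraph:
  "G \<subseteq> complete_edges n \<Longrightarrow> triangles G = {t \<in> triangles (complete_edges n). t \<subseteq> G}"
  using triangles_iff by blast

lemma finite_triangles_complete: "finite (triangles (complete_edges n))"
  by (intro finite_triangles finite_complete_edges)

lemma card_triangles_complete_le: "card (triangles (complete_edges n)) \<le> n ^ 3"
proof -
  let ?V = "{1..n}"
  have "triangles (complete_edges n) \<subseteq> (\<lambda>(x, y, z). tri x y z) ` (?V \<times> ?V \<times> ?V)"
    by (auto simp: triangles_eq tri_def complete_edges_def)
  then have "card (triangles (complete_edges n)) \<le> card ((\<lambda>(x, y, z). tri x y z) ` (?V \<times> ?V \<times> ?V))"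
    by (intro card_mono) auto
  also have "\<dots> \<le> card (?V \<times> ?V \<times> ?V)" by (intro card_image_le) auto
  also have "\<dots> = n ^ 3" by (simp add: card_cartesian_product power3_eq_cube)
  finally show ?thesis .
qed

text \<open>Taking vertex sets maps the triangles onto the 3-subsets, and \<open>n choose 3\<close>
  is at least \<open>(n / 3) ^ 3\<close>.\<close>

lemma card_triangles_complete_ge:
  assumes "n \<ge> 3"
  shows "real n ^ 3 / 27 \<le> real (card (triangles (complete_edges n)))"
proof -
  have "{X. X \<subseteq> {1..n} \<and> card X = 3} \<subseteq> Union ` triangles (complete_edges n)"
  proof
    fix X assume X: "X \<in> {X. X \<subseteq> {1..n} \<and> card X = 3}"
    then obtain x y z where xyz: "X = {x, y, z}" "x \<noteq> y" "y \<noteq> z" "x \<noteq> z"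
      unfolding mem_Collect_eq card_3_iff by blast
    have "x \<in> {1..n}" "y \<in> {1..n}" "z \<in> {1..n}" using X xyz(1) by blast+
    then have "tri x y z \<subseteq> complete_edges n"
      using xyz(2-4) by (simp add: tri_def complete_edges_def)
    then have "tri x y z \<in> triangles (complete_edges n)"
      unfolding triangles_eq mem_Collect_eq using xyz(2-4) by metis
    moreover have "\<Union>(tri x y z) = X" using xyz by (auto simp: tri_def)
    ultimately show "X \<in> Union ` triangles (complete_edges n)" by blast
  qed
  then have "card {X. X \<subseteq> {1..n} \<and> card X = 3} \<le> card (triangles (complete_edges n))"
    by (rule surj_card_le[OF finite_triangles_complete])
  then have "n choose 3 \<le> card (triangles (complete_edges n))" by (simp add: n_subsets)
  moreover have "(real n / 3) ^ 3 \<le> real (n choose 3)"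
    using binomial_ge_n_over_k_pow_k[OF assms, where 'a = real] by simp
  ultimately show ?thesis by (simp add: power_divide)
qed

lemma expectation_card_triangles:
  assumes "p \<in> {0..1}"
  shows "measure_pmf.expectation (gnp n p) (\<lambda>G. real (card {t \<in> triangles (complete_edges n). t \<subseteq> G})) =
    real (card (triangles (complete_edges n))) * p ^ 3"
  using expectation_gnp_card_supersets[OF assms finite_triangles_complete, of n "\<lambda>t. t"]
  by (simp add: triangles_subset card_triangle)

text \<open>The two sources of randomness multiply: an edge of a strip is present and kept with
  probability \<open>(1 - \<delta>) * p\<close>.\<close>

lemma expectation_excess_bound:
  assumes "p \<in> {0..1}" "\<delta> \<in> {0..1}"
  shows "measure_pmf.expectation (gnp n p) (excess_bound n \<delta>) \<le> 3 * \<delta> * (real n ^ 3 * p ^ 3) +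
    (\<Sum>k=1..n. (real n)\<^sup>2 * (2 * real n) ^ k * (real k + 2) * ((1 - \<delta>) * p) ^ (2 * k + 2))"
proof -
  let ?E = "measure_pmf.expectation (gnp n p)"
  let ?T = "triangles (complete_edges n)"
  have "?E (excess_bound n \<delta>) \<le> ?E (\<lambda>G. 3 * \<delta> * real (card {t \<in> ?T. t \<subseteq> G}) +
      (\<Sum>k=1..n. (1 - \<delta>) ^ (2 * k + 2) *
        real (card {s \<in> chorded_strips n k. chorded_strip_edges s \<subseteq> G})))"
    by (intro expectation_gnp_mono) (simp add: excess_bound_def triangles_subgraph)
  also have "\<dots> = 3 * \<delta> * (real (card ?T) * p ^ 3) +
      (\<Sum>k=1..n. (1 - \<delta>) ^ (2 * k + 2) *
        ?E (\<lambda>G. real (card {s \<in> chorded_strips n k. chorded_strip_edges s \<subseteq> G})))"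
    by (simp add: integrable_gnp expectation_card_triangles[OF assms(1)])
  also have "\<dots> = 3 * \<delta> * (real (card ?T) * p ^ 3) +
      (\<Sum>k=1..n. (1 - \<delta>) ^ (2 * k + 2) * (real (card (chorded_strips n k)) * p ^ (2 * k + 2)))"
  proof (intro arg_cong2[where f = "(+)"] arg_cong2[where f = "(*)"] sum.cong refl)
    fix k assume k: "k \<in> {1..n}"
    have "?E (\<lambda>G. real (card {s \<in> chorded_strips n k. chorded_strip_edges s \<subseteq> G})) =
      (\<Sum>s\<in>chorded_strips n k. p ^ card (chorded_strip_edges s))"
      using k chorded_strip_edges_subset[of _ n k]
      by (intro expectation_gnp_card_supersets assms(1) finite_chorded_strips) auto
    also have "\<dots> = (\<Sum>s\<in>chorded_strips n k. p ^ (2 * k + 2))"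
      using card_chorded_strip_edges[of _ n k] by (intro sum.cong refl) metis
    finally show "?E (\<lambda>G. real (card {s \<in> chorded_strips n k. chorded_strip_edges s \<subseteq> G})) =
      real (card (chorded_strips n k)) * p ^ (2 * k + 2)" by simp
  qed
  also have "\<dots> \<le> 3 * \<delta> * (real n ^ 3 * p ^ 3) +
      (\<Sum>k=1..n. (1 - \<delta>) ^ (2 * k + 2) * (((real n)\<^sup>2 * (2 * real n) ^ k * (real k + 2)) * p ^ (2 * k + 2)))"
  proof (intro add_mono sum_mono mult_left_mono mult_right_mono)
    show "real (card ?T) \<le> real n ^ 3"
      using card_triangles_complete_le[of n] by (metis of_nat_le_iff of_nat_power)
    fix k
    have "real (card (chorded_strips n k)) \<le> real (n\<^sup>2 * (2 * n) ^ k * (k + 2))"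
      using card_chorded_strips[of n k] of_nat_le_iff by blast
    then show "real (card (chorded_strips n k)) \<le> (real n)\<^sup>2 * (2 * real n) ^ k * (real k + 2)"
      by (simp only: of_nat_mult of_nat_power of_nat_add of_nat_numeral)
  qed (use assms in auto)
  also have "\<dots> = 3 * \<delta> * (real n ^ 3 * p ^ 3) +
    (\<Sum>k=1..n. (real n)\<^sup>2 * (2 * real n) ^ k * (real k + 2) * ((1 - \<delta>) * p) ^ (2 * k + 2))"
    unfolding power_mult_distrib by (simp only: mult_ac)
  finally show ?thesis .
qed

text \<open>Compare with the differentiated geometric series at \<open>y\<close>.\<close>

lemma sum_Suc_mult_power_le:
  fixes x y :: real
  assumes "0 \<le> x" "x \<le> y" "y < 1"
  shows "(\<Sum>j<n. real (Suc j) * x ^ j) \<le> 1 / (1 - y)\<^sup>2"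
proof -
  have s: "(\<lambda>j. real (Suc j) * y ^ j) sums (1 / (1 - y)\<^sup>2)"
    using geometric_deriv_sums[of y] assms by simp
  have "(\<Sum>j<n. real (Suc j) * x ^ j) \<le> (\<Sum>j<n. real (Suc j) * y ^ j)"
    using assms by (intro sum_mono mult_left_mono power_mono) auto
  also have "\<dots> \<le> (\<Sum>j. real (Suc j) * y ^ j)"
    using s assms by (intro sum_le_suminf) (auto simp: sums_iff)
  finally show ?thesis using s by (simp add: sums_iff)
qed

text \<open>Thinning by a constant factor makes the exploration of triangles strictly subcritical, so the
  expected number of chorded strips is bounded by a convergent series.\<close>

lemma expectation_excess_bound_subcritical:
  assumes "p \<in> {0..1}" "(real n - 2) * p\<^sup>2 \<le> 1 / 2" "0 < \<delta>" "\<delta> \<le> 1" "2 / \<delta> \<le> real n"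
  shows "measure_pmf.expectation (gnp n p) (excess_bound n \<delta>) \<le>
    (3 * \<delta> + 6 * p / \<delta>\<^sup>2) * (real n ^ 3 * p ^ 3)"
proof -
  define q where "q = (1 - \<delta>) * p"
  define x where "x = 2 * real n * q\<^sup>2"
  have q: "0 \<le> q" "q \<le> p"
    using assms by (auto simp: q_def mult_left_le_one_le)
  \<comment> \<open>One of the two factors \<open>1 - \<delta>\<close> in \<open>q\<^sup>2\<close>
    lowers \<open>n\<close> to at most \<open>n - 2\<close>, so that \<open>d \<le> 1 / 2\<close>
    applies; the other one remains as the subcritical gap.\<close>
  have "x \<le> 1 - \<delta>"
  proof -
    have "2 \<le> real n * \<delta>" using assms(3,5) by (simp add: field_simps)
    then have "real n * (1 - \<delta>) \<le> real n - 2" by (simp add: algebra_simps)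
    then have "real n * (1 - \<delta>) * p\<^sup>2 \<le> (real n - 2) * p\<^sup>2" by (intro mult_right_mono) auto
    then have "2 * (real n * (1 - \<delta>) * p\<^sup>2) \<le> 1" using assms(2) by linarith
    then have "(1 - \<delta>) * (2 * (real n * (1 - \<delta>) * p\<^sup>2)) \<le> (1 - \<delta>) * 1"
      using assms(4) by (intro mult_left_mono) auto
    then show ?thesis by (simp add: x_def q_def power2_eq_square algebra_simps)
  qed
  moreover have "0 \<le> x" by (simp add: x_def)
  ultimately have geo: "(\<Sum>j<n. real (Suc j) * x ^ j) \<le> 1 / \<delta>\<^sup>2"
    using sum_Suc_mult_power_le[of x "1 - \<delta>" n] assms(3) by simp
  have "(\<Sum>k=1..n. (real n)\<^sup>2 * (2 * real n) ^ k * (real k + 2) * q ^ (2 * k + 2)) =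
      (\<Sum>j<n. (real n)\<^sup>2 * (2 * real n) ^ Suc j * (real (Suc j) + 2) * q ^ (2 * Suc j + 2))"
    by (rule sum.reindex_bij_witness[where i = Suc and j = "\<lambda>k. k - 1"]) auto
  also have "\<dots> = (\<Sum>j<n. 2 * real n ^ 3 * q ^ 4 * ((real j + 3) * x ^ j))"
  proof (intro sum.cong refl)
    fix j
    have x: "x ^ j = (2 * real n) ^ j * q ^ (2 * j)"
      by (simp add: x_def power_mult_distrib power_mult)
    have "2 * Suc j + 2 = 2 * j + 4" by simp
    then have q': "q ^ (2 * Suc j + 2) = q ^ (2 * j) * q ^ 4" by (simp only: power_add)
    \<comment> \<open>The powers with variable exponents are abstracted to \<open>C\<close> and
      \<open>A\<close>, which leaves a polynomial identity.\<close>
    have "N\<^sup>2 * (2 * N * C) * (1 + J + 2) * (A * B) = 2 * N ^ 3 * B * ((J + 3) * (C * A))"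
      for A B C J N :: real by algebra
    then show "(real n)\<^sup>2 * (2 * real n) ^ Suc j * (real (Suc j) + 2) * q ^ (2 * Suc j + 2) =
        2 * real n ^ 3 * q ^ 4 * ((real j + 3) * x ^ j)"
      unfolding x q' power_Suc of_nat_Suc by blast
  qed
  also have "\<dots> \<le> (\<Sum>j<n. 2 * real n ^ 3 * q ^ 4 * (3 * (real (Suc j) * x ^ j)))"
  proof (intro sum_mono mult_left_mono)
    fix j
    have "(real j + 3) * x ^ j \<le> (3 * real (Suc j)) * x ^ j"
      using \<open>0 \<le> x\<close> by (intro mult_right_mono) auto
    then show "(real j + 3) * x ^ j \<le> 3 * (real (Suc j) * x ^ j)" by (simp only: mult.assoc)
  qed (use q in auto)
  also have "\<dots> = 2 * real n ^ 3 * q ^ 4 * (3 * (\<Sum>j<n. real (Suc j) * x ^ j))"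
    by (simp only: sum_distrib_left)
  also have "\<dots> \<le> 2 * real n ^ 3 * p ^ 4 * (3 * (1 / \<delta>\<^sup>2))"
    using q \<open>0 \<le> x\<close> by (intro mult_mono geo power_mono mult_nonneg_nonneg sum_nonneg order_refl) auto
  also have "\<dots> = 6 * p / \<delta>\<^sup>2 * (real n ^ 3 * p ^ 3)"
    by (simp add: power4_eq_xxxx power3_eq_cube)
  finally show ?thesis
    using expectation_excess_bound[of p \<delta> n] assms(1,3,4)
    by (simp add: q_def distrib_right)
qed

section \<open>The packing number is of the order of the expected number of triangles\<close>

text \<open>The ordered pairs sharing an edge, diagonal included. They govern both the variance of
  the triangle count and the Turan-type bound on the packing.\<close>

definition triangle_pairs :: "nat \<Rightarrow> (nat set set \<times> nat set set) set" where
  "triangle_pairs n = {(t, u) \<in> triangles (complete_edges n) \<times> triangles (complete_edges n). \<not> disjnt t u}"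

lemma finite_triangle_pairs: "finite (triangle_pairs n)"
  by (rule finite_subset[of _ "triangles (complete_edges n) \<times> triangles (complete_edges n)"])
    (auto simp: triangle_pairs_def finite_triangles_complete)

lemma triangle_pairs_cases:
  assumes "(t, u) \<in> triangle_pairs n" "t \<noteq> u"
  obtains x y z w where "t = tri x y z" "u = tri x y w" "x \<noteq> y" "z \<noteq> x" "z \<noteq> y" "w \<noteq> x" "w \<noteq> y" "z \<noteq> w"
    "x \<in> {1..n}" "y \<in> {1..n}" "z \<in> {1..n}" "w \<in> {1..n}"
proof -
  have tu: "t \<in> triangles (complete_edges n)" "u \<in> triangles (complete_edges n)"
    using assms(1) by (auto simp: triangle_pairs_def)
  obtain e where e: "e \<in> t" "e \<in> u" using assms(1) by (auto simp: triangle_pairs_def disjnt_def)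
  obtain x y where xy: "e = {x, y}" using triangle_edge[OF tu(1) e(1)] .
  obtain z where z: "t = tri x y z" "z \<noteq> x" "z \<noteq> y" "x \<noteq> y"
    using triangle_eq_tri[OF tu(1)] e xy by metis
  obtain w where w: "u = tri x y w" "w \<noteq> x" "w \<noteq> y"
    using triangle_eq_tri[OF tu(2)] e xy by metis
  have "t \<subseteq> complete_edges n" "u \<subseteq> complete_edges n" using tu triangles_subset by auto
  then have "{x, y, z, w} \<subseteq> {1..n}" by (simp add: z(1) w(1) tri_def complete_edges_def)
  moreover have "z \<noteq> w" using assms(2) z(1) w(1) by auto
  ultimately show thesis using that z w by simp
qed

text \<open>The diagonal gives the first term. Two distinct triangles on a common edge span four
  vertices and five edges, which gives the second.\<close>

lemma sum_triangle_pairs_le: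
  assumes "0 \<le> p"
  shows "(\<Sum>(t, u)\<in>triangle_pairs n. p ^ card (t \<union> u)) \<le> real n ^ 3 * p ^ 3 + real n ^ 4 * p ^ 5"
proof -
  let ?T = "triangles (complete_edges n)" and ?V = "{1..n}"
  define D where "D = (\<lambda>t. (t, t)) ` ?T"
  define O' where "O' = {(t, u) \<in> triangle_pairs n. t \<noteq> u}"
  have fin: "finite D" "finite O'"
    using finite_triangles_complete finite_triangle_pairs
    by (auto simp: D_def O'_def intro: finite_subset[of _ "triangle_pairs n"])
  have "triangle_pairs n \<subseteq> D \<union> O'" by (auto simp: triangle_pairs_def D_def O'_def)
  then have "(\<Sum>(t, u)\<in>triangle_pairs n. p ^ card (t \<union> u)) \<le> (\<Sum>(t, u)\<in>D \<union> O'. p ^ card (t \<union> u))"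
    using fin assms by (intro sum_mono2) auto
  also have "\<dots> = (\<Sum>(t, u)\<in>D. p ^ card (t \<union> u)) + (\<Sum>(t, u)\<in>O'. p ^ card (t \<union> u))"
    using fin by (intro sum.union_disjoint) (auto simp: D_def O'_def)
  also have "(\<Sum>(t, u)\<in>D. p ^ card (t \<union> u)) = (\<Sum>t\<in>?T. p ^ card t)"
    unfolding D_def by (subst sum.reindex) (auto simp: inj_on_def)
  also have "\<dots> = real (card ?T) * p ^ 3" by (simp add: card_triangle)
  also have "\<dots> \<le> real n ^ 3 * p ^ 3"
    using card_triangles_complete_le[of n] assms
    by (intro mult_right_mono) (auto simp flip: of_nat_power)
  also have "(\<Sum>(t, u)\<in>O'. p ^ card (t \<union> u)) = (\<Sum>s\<in>O'. p ^ 5)"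
  proof (intro sum.cong refl, clarify)
    fix t u assume "(t, u) \<in> O'"
    then have "(t, u) \<in> triangle_pairs n" "t \<noteq> u" by (auto simp: O'_def)
    then obtain x y z w where "t = tri x y z" "u = tri x y w" and
      *: "x \<noteq> y" "z \<noteq> x" "z \<noteq> y" "w \<noteq> x" "w \<noteq> y" "z \<noteq> w"
      using triangle_pairs_cases by metis
    then have "t \<union> u = {{x, y}, {y, z}, {x, z}, {y, w}, {x, w}}" by (auto simp: tri_def)
    also have "card \<dots> = 5" using * by (auto simp: card_insert_if doubleton_eq_iff)
    finally show "p ^ card (t \<union> u) = p ^ 5" by simp
  qed
  also have "\<dots> = real (card O') * p ^ 5" by simp
  also have "card O' \<le> n ^ 4"
  proof -
    have "O' \<subseteq> (\<lambda>(x, y, z, w). (tri x y z, tri x y w)) ` (?V \<times> ?V \<times> ?V \<times> ?V)"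
    proof
      fix s assume s: "s \<in> O'"
      obtain t u where tu: "s = (t, u)" by (cases s)
      then have "(t, u) \<in> triangle_pairs n" "t \<noteq> u" using s by (auto simp: O'_def)
      then obtain x y z w where "t = tri x y z" "u = tri x y w"
        "x \<in> ?V" "y \<in> ?V" "z \<in> ?V" "w \<in> ?V"
        by (rule triangle_pairs_cases)
      then show "s \<in> (\<lambda>(x, y, z, w). (tri x y z, tri x y w)) ` (?V \<times> ?V \<times> ?V \<times> ?V)"
        by (intro image_eqI[of _ _ "(x, y, z, w)"]) (simp_all add: tu)
    qed
    then have "card O' \<le> card ((\<lambda>(x, y, z, w). (tri x y z, tri x y w)) ` (?V \<times> ?V \<times> ?V \<times> ?V))"
      by (intro card_mono) auto
    also have "\<dots> \<le> card (?V \<times> ?V \<times> ?V \<times> ?V)" by (intro card_image_le) auto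
    also have "\<dots> = n ^ 4" by (simp add: card_cartesian_product power4_eq_xxxx)
    finally show ?thesis .
  qed
  then have "real (card O') * p ^ 5 \<le> real n ^ 4 * p ^ 5"
    using assms by (intro mult_right_mono) (auto simp flip: of_nat_power)
  finally show ?thesis by simp
qed

lemma card_triangles_power2_le:
  assumes "G \<subseteq> complete_edges n"
  shows "(real (card (triangles G)))\<^sup>2 \<le>
    4 * real (\<nu> G) * real (card {s \<in> triangle_pairs n. fst s \<union> snd s \<subseteq> G})"
proof -
  have "finite G" using assms finite_complete_edges finite_subset by blast
  have "{} \<notin> triangles G" using card_triangle[of "{}" G] by auto
  then obtain P where P: "P \<subseteq> triangles G" "pairwise disjnt P" "(card (triangles G))\<^sup>2 \<le>
      4 * card P * card {(t, u). t \<in> triangles G \<and> u \<in> triangles G \<and> \<not> disjnt t u}"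
    using packing_ge_card_power2_div_intersecting_pairs[of "triangles G"]
      finite_triangles[OF \<open>finite G\<close>] by blast
  have eq: "{(t, u). t \<in> triangles G \<and> u \<in> triangles G \<and> \<not> disjnt t u} =
      {s \<in> triangle_pairs n. fst s \<union> snd s \<subseteq> G}" (is "_ = ?S")
    by (auto simp: triangles_subgraph[OF assms] triangle_pairs_def)
  have "(card (triangles G))\<^sup>2 \<le> 4 * card P * card ?S" using P(3) unfolding eq .
  also have "\<dots> \<le> 4 * \<nu> G * card ?S"
    using P(1,2) \<open>finite G\<close> by (intro mult_le_mono order_refl card_le_packing_number)
  finally have "real ((card (triangles G))\<^sup>2) \<le> real (4 * \<nu> G * card ?S)"
    by (simp only: of_nat_le_iff)
  then show ?thesis by simp
qed

lemma expectation_triangle_pairs: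
  assumes "p \<in> {0..1}"
  shows "measure_pmf.expectation (gnp n p)
      (\<lambda>G. real (card {s \<in> triangle_pairs n. fst s \<union> snd s \<subseteq> G})) =
    (\<Sum>(t, u)\<in>triangle_pairs n. p ^ card (t \<union> u))"
proof -
  have "fst s \<union> snd s \<subseteq> complete_edges n" if "s \<in> triangle_pairs n" for s
    using that triangles_subset by (fastforce simp: triangle_pairs_def)
  then show ?thesis
    using expectation_gnp_card_supersets[OF assms finite_triangle_pairs, of n "\<lambda>s. fst s \<union> snd s"]
    by (simp add: case_prod_unfold)
qed

text \<open>The square of the count runs over ordered pairs. Edge-disjoint pairs have six edges and
  contribute at most \<open>\<mu>\<^sup>2\<close>, which cancels, so only pairs sharing an edge
  remain.\<close>

lemma variance_card_triangles_le:
  fixes n :: nat and p :: real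
  assumes "p \<in> {0..1}"
  defines "\<mu> \<equiv> real (card (triangles (complete_edges n))) * p ^ 3"
  shows "measure_pmf.expectation (gnp n p)
      (\<lambda>G. (real (card {t \<in> triangles (complete_edges n). t \<subseteq> G}) - \<mu>)\<^sup>2) \<le>
    (\<Sum>(t, u)\<in>triangle_pairs n. p ^ card (t \<union> u))"
proof -
  let ?T = "triangles (complete_edges n)" and ?E = "measure_pmf.expectation (gnp n p)"
  let ?X = "\<lambda>G. real (card {t \<in> ?T. t \<subseteq> G})"
  have finT: "finite ?T" by (rule finite_triangles_complete)
  have sq: "(?X G)\<^sup>2 = real (card {s \<in> ?T \<times> ?T. fst s \<union> snd s \<subseteq> G})" for G
  proof -
    have "{s \<in> ?T \<times> ?T. fst s \<union> snd s \<subseteq> G} = {t \<in> ?T. t \<subseteq> G} \<times> {t \<in> ?T. t \<subseteq> G}" by auto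
    then show ?thesis by (simp add: card_cartesian_product power2_eq_square)
  qed
  have "fst s \<union> snd s \<subseteq> complete_edges n" if "s \<in> ?T \<times> ?T" for s
    using that triangles_subset by fastforce
  then have "?E (\<lambda>G. (?X G)\<^sup>2) = (\<Sum>s\<in>?T \<times> ?T. p ^ card (fst s \<union> snd s))"
    unfolding sq using finT by (intro expectation_gnp_card_supersets assms(1)) auto
  also have "\<dots> \<le> (\<Sum>s\<in>triangle_pairs n. p ^ card (fst s \<union> snd s)) + (\<Sum>s\<in>?T \<times> ?T. p ^ 6)"
  proof -
    have sub: "triangle_pairs n \<subseteq> ?T \<times> ?T" by (auto simp: triangle_pairs_def)
    have "(\<Sum>s\<in>?T \<times> ?T. p ^ card (fst s \<union> snd s)) =
      (\<Sum>s\<in>?T \<times> ?T - triangle_pairs n. p ^ card (fst s \<union> snd s)) +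
      (\<Sum>s\<in>triangle_pairs n. p ^ card (fst s \<union> snd s))"
      using finT by (intro sum.subset_diff[OF sub]) auto
    also have "(\<Sum>s\<in>?T \<times> ?T - triangle_pairs n. p ^ card (fst s \<union> snd s)) =
      (\<Sum>s\<in>?T \<times> ?T - triangle_pairs n. p ^ 6)"
    proof (intro sum.cong refl)
      fix s assume s: "s \<in> ?T \<times> ?T - triangle_pairs n"
      then have c: "card (fst s) = 3" "card (snd s) = 3" using card_triangle by auto
      moreover have "finite (fst s)" "finite (snd s)" using c by (auto intro: card_ge_0_finite)
      moreover have "fst s \<inter> snd s = {}" using s by (auto simp: triangle_pairs_def disjnt_def)
      ultimately have "card (fst s \<union> snd s) = 6" by (simp add: card_Un_disjoint)
      then show "p ^ card (fst s \<union> snd s) = p ^ 6" by simp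
    qed
    also have "\<dots> \<le> (\<Sum>s\<in>?T \<times> ?T. p ^ 6)"
      using finT assms(1) by (intro sum_mono2) auto
    finally show ?thesis by simp
  qed
  also have "(\<Sum>s\<in>?T \<times> ?T. p ^ 6) = \<mu>\<^sup>2"
    by (simp add: \<mu>_def card_cartesian_product power2_eq_square flip: power_add)
  finally have second: "?E (\<lambda>G. (?X G)\<^sup>2) \<le>
      (\<Sum>s\<in>triangle_pairs n. p ^ card (fst s \<union> snd s)) + \<mu>\<^sup>2" .
  have "?E (\<lambda>G. (?X G - \<mu>)\<^sup>2) = ?E (\<lambda>G. (?X G)\<^sup>2 - 2 * \<mu> * ?X G + \<mu>\<^sup>2)"
    by (simp add: power2_diff algebra_simps)
  also have "\<dots> = ?E (\<lambda>G. (?X G)\<^sup>2) - 2 * \<mu> * ?E ?X + \<mu>\<^sup>2"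
    by (simp add: integrable_gnp)
  also have "?E ?X = \<mu>" unfolding \<mu>_def by (rule expectation_card_triangles[OF assms(1)])
  finally show ?thesis using second by (simp add: power2_eq_square case_prod_unfold)
qed

section \<open>Few and many expected triangles, and the limit\<close>

lemma prob_ge_of_three_bad_events:
  assumes "\<And>G. G \<in> set_pmf M \<Longrightarrow> G \<notin> A \<Longrightarrow> G \<notin> B \<Longrightarrow> G \<notin> C \<Longrightarrow> G \<in> D"
  shows "measure_pmf.prob M D \<ge>
    1 - (measure_pmf.prob M A + measure_pmf.prob M B + measure_pmf.prob M C)"
proof -
  have "1 = measure_pmf.prob M UNIV" by simp
  also have "\<dots> \<le> measure_pmf.prob M (D \<union> (A \<union> (B \<union> C)))"
    using assms by (intro measure_pmf.finite_measure_mono_AE) (auto simp: AE_measure_pmf_iff)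
  also have "\<dots> \<le> measure_pmf.prob M D + (measure_pmf.prob M A + (measure_pmf.prob M B + measure_pmf.prob M C))"
    by (intro order_trans[OF measure_Un_le] add_left_mono) auto
  finally show ?thesis by simp
qed

text \<open>By Markov's inequality the excess is below 1 except with probability
  \<open>\<gamma>\<close>, and then integrality forces
  \<open>\<tau> G \<le> \<nu> G\<close>.\<close>

lemma prob_cover_le_packing_small:
  assumes "\<delta> \<in> {0..1}" "0 < \<epsilon>"
    and "measure_pmf.expectation (gnp n p) (excess_bound n \<delta>) \<le> \<gamma>"
  shows "measure_pmf.prob (gnp n p) {G. real (\<tau> G) \<le> (1 + \<epsilon>) * real (\<nu> G)} \<ge> 1 - \<gamma>"
proof -
  let ?B = "{G. 1 \<le> excess_bound n \<delta> G}"
  have "1 - (measure_pmf.prob (gnp n p) ?B + measure_pmf.prob (gnp n p) {} + measure_pmf.prob (gnp n p) {}) \<le>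
    measure_pmf.prob (gnp n p) {G. real (\<tau> G) \<le> (1 + \<epsilon>) * real (\<nu> G)}"
  proof (rule prob_ge_of_three_bad_events)
    fix G assume "G \<in> set_pmf (gnp n p)" "G \<notin> ?B"
    then have "real (\<tau> G) < real (\<nu> G) + 1"
      using cover_number_le_excess_bound[of G n \<delta>] set_pmf_gnp[of G n p] assms(1) by auto
    then have "\<tau> G \<le> \<nu> G" by linarith
    moreover have "0 \<le> \<epsilon> * real (\<nu> G)" using assms(2) by simp
    ultimately show "G \<in> {G. real (\<tau> G) \<le> (1 + \<epsilon>) * real (\<nu> G)}"
      by (simp add: distrib_right)
  qed
  moreover have "measure_pmf.prob (gnp n p) ?B \<le> \<gamma>"
    using gnp_Markov[of "excess_bound n \<delta>" 1 n p] excess_bound_nonneg[OF assms(1)] assms(3) by auto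
  ultimately show ?thesis by simp
qed

text \<open>Bad events: too many intersecting pairs, a triangle count far from its mean, a large
  excess. Outside them \<open>\<nu> G\<close> is at least \<open>L / (23328 * K)\<close>, so the
  excess is less than \<open>\<epsilon> * \<nu> G\<close>.\<close>

lemma prob_cover_le_packing_large:
  fixes n :: nat and p \<delta> \<epsilon> \<rho> K :: real
  defines "L \<equiv> real n ^ 3 * p ^ 3"
  assumes "p \<in> {0..1}" "\<delta> \<in> {0..1}" "0 < \<epsilon>" "0 < K" "n \<ge> 3" "real n * p\<^sup>2 \<le> 1" "0 < L"
    and excess: "measure_pmf.expectation (gnp n p) (excess_bound n \<delta>) \<le> \<rho> * L"
  shows "measure_pmf.prob (gnp n p) {G. real (\<tau> G) \<le> (1 + \<epsilon>) * real (\<nu> G)} \<ge>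
    1 - (1 / K + 5832 / L + 23328 * K * \<rho> / \<epsilon>)"
proof -
  let ?M = "gnp n p" and ?E = "measure_pmf.expectation (gnp n p)"
  let ?T = "triangles (complete_edges n)"
  define X where "X G = real (card {t \<in> ?T. t \<subseteq> G})" for G
  define Q where "Q G = real (card {s \<in> triangle_pairs n. fst s \<union> snd s \<subseteq> G})" for G
  define \<mu> where "\<mu> = real (card ?T) * p ^ 3"
  \<comment> \<open>Here 23328 is 8 times the square of 54, from
    \<open>(L / 54)\<^sup>2 \<le> 4 * \<nu> G * (2 * K * L)\<close>.\<close>
  define c where "c = \<epsilon> * L / (23328 * K)"
  have c: "c > 0" using assms by (simp add: c_def)
  have "(\<Sum>(t, u)\<in>triangle_pairs n. p ^ card (t \<union> u)) \<le> L + real n ^ 4 * p ^ 5"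
    using sum_triangle_pairs_le[of p n] assms(2) by (simp add: L_def)
  also have "real n ^ 4 * p ^ 5 = L * (real n * p\<^sup>2)"
    unfolding L_def by algebra
  also have "\<dots> \<le> L * 1" using assms by (intro mult_left_mono) auto
  finally have pairs: "(\<Sum>(t, u)\<in>triangle_pairs n. p ^ card (t \<union> u)) \<le> 2 * L" by simp
  have EQ: "?E Q \<le> 2 * L"
    using expectation_triangle_pairs[OF assms(2), of n] pairs by (simp add: Q_def[abs_def])
  have VX: "?E (\<lambda>G. (X G - \<mu>)\<^sup>2) \<le> 2 * L"
    using variance_card_triangles_le[OF assms(2), of n] pairs by (simp add: X_def \<mu>_def)
  have \<mu>: "L / 27 \<le> \<mu>"
    using mult_right_mono[OF card_triangles_complete_ge[OF \<open>n \<ge> 3\<close>], of "p ^ 3"] assms(2)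
    by (simp add: L_def \<mu>_def)
  \<comment> \<open>The deviation \<open>L / 54\<close> is half of the lower bound
    \<open>L / 27\<close> for the mean; \<open>2 * K * L\<close> is \<open>K\<close> times the bound
    on the mean of \<open>Q\<close>.\<close>
  let ?A = "{G. 2 * K * L \<le> Q G}" and ?B = "{G. (L / 54)\<^sup>2 \<le> (X G - \<mu>)\<^sup>2}"
    and ?C = "{G. c \<le> excess_bound n \<delta> G}"
  have "1 - (measure_pmf.prob ?M ?A + measure_pmf.prob ?M ?B + measure_pmf.prob ?M ?C) \<le>
    measure_pmf.prob ?M {G. real (\<tau> G) \<le> (1 + \<epsilon>) * real (\<nu> G)}"
  proof (rule prob_ge_of_three_bad_events)
    fix G assume G: "G \<in> set_pmf ?M" "G \<notin> ?A" "G \<notin> ?B" "G \<notin> ?C"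
    have sub: "G \<subseteq> complete_edges n" using G(1) by (rule set_pmf_gnp)
    have "\<bar>X G - \<mu>\<bar> < L / 54"
      using G(3) assms(8) abs_le_square_iff[of "L / 54" "X G - \<mu>"] by auto
    then have X: "L / 54 \<le> X G" using \<mu> by linarith
    have "(L / 54)\<^sup>2 \<le> (X G)\<^sup>2" using X assms(8) by (intro power_mono) auto
    also have "\<dots> \<le> 4 * real (\<nu> G) * Q G"
      using card_triangles_power2_le[OF sub] unfolding triangles_subgraph[OF sub] X_def Q_def .
    also have "\<dots> \<le> 4 * real (\<nu> G) * (2 * K * L)" using G(2) by (intro mult_left_mono) auto
    finally have "L * L \<le> L * (23328 * K * real (\<nu> G))"
      by (simp add: power2_eq_square algebra_simps)
    then have "L \<le> 23328 * K * real (\<nu> G)" using assms(8) by simp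
    then have "\<epsilon> * L \<le> \<epsilon> * (23328 * K * real (\<nu> G))" using assms(4) by simp
    then have "c \<le> \<epsilon> * real (\<nu> G)"
      using assms(5) by (simp add: c_def field_simps)
    moreover have "real (\<tau> G) \<le> real (\<nu> G) + excess_bound n \<delta> G"
      by (rule cover_number_le_excess_bound[OF sub assms(3)])
    ultimately show "G \<in> {G. real (\<tau> G) \<le> (1 + \<epsilon>) * real (\<nu> G)}"
      using G(4) by (simp add: distrib_right)
  qed
  moreover have "measure_pmf.prob ?M ?A \<le> 1 / K"
  proof -
    have "measure_pmf.prob ?M ?A \<le> ?E Q / (2 * K * L)"
      using assms by (intro gnp_Markov) (auto simp: Q_def)
    also have "\<dots> \<le> 2 * L / (2 * K * L)" using EQ assms by (intro divide_right_mono) auto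
    also have "\<dots> = 1 / K" using \<open>0 < K\<close> \<open>0 < L\<close> by (cases "L = 0") auto
    finally show ?thesis .
  qed
  moreover have "measure_pmf.prob ?M ?B \<le> 5832 / L"
  proof -
    have "measure_pmf.prob ?M ?B \<le> ?E (\<lambda>G. (X G - \<mu>)\<^sup>2) / (L / 54)\<^sup>2"
      using assms by (intro gnp_Markov) auto
    also have "\<dots> \<le> 2 * L / (L / 54)\<^sup>2" using VX by (intro divide_right_mono) auto
    also have "\<dots> = 5832 / L" using \<open>0 < L\<close> by (cases "L = 0") (auto simp: power2_eq_square)
    finally show ?thesis .
  qed
  moreover have "measure_pmf.prob ?M ?C \<le> 23328 * K * \<rho> / \<epsilon>"
  proof -
    have "measure_pmf.prob ?M ?C \<le> ?E (excess_bound n \<delta>) / c"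
      using c excess_bound_nonneg[OF assms(3)] by (intro gnp_Markov) auto
    also have "\<dots> \<le> \<rho> * L / c" using excess c by (intro divide_right_mono) auto
    also have "\<dots> = 23328 * K * \<rho> / \<epsilon>"
      using \<open>0 < L\<close> \<open>0 < K\<close> \<open>0 < \<epsilon>\<close> unfolding c_def by (cases "L = 0") auto
    finally show ?thesis .
  qed
  ultimately show ?thesis by linarith
qed

theorem theorem1p3:
  fixes p :: "nat \<Rightarrow> real"
  assumes "\<And>n. p n \<in> {0..1}"
    and "\<And>n. (real n - 2) * (p n)\<^sup>2 \<le> 1 / 2"
  shows "\<forall>\<epsilon>::real. \<epsilon> > 0 \<longrightarrow>
    (\<lambda>n. measure_pmf.prob (gnp n (p n)) {G. real (\<tau> G) \<le> (1 + \<epsilon>) * real (\<nu> G)})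
      \<longlonglongrightarrow> 1"
proof (intro allI impI)
  fix \<epsilon> :: real assume "\<epsilon> > 0"
  let ?P = "\<lambda>n. measure_pmf.prob (gnp n (p n)) {G. real (\<tau> G) \<le> (1 + \<epsilon>) * real (\<nu> G)}"
  have main: "\<forall>\<^sub>F n in sequentially. ?P n \<ge> 1 - \<gamma>" if "\<gamma> > 0" for \<gamma>
  proof -
    \<comment> \<open>With these choices each of the three error terms is at most
      \<open>\<gamma> / 4\<close> when \<open>L > M\<close>, while
      \<open>\<rho> * M \<le> \<gamma>\<close> serves for \<open>L \<le> M\<close>. The constants
      \<open>\<delta>\<close> and \<open>\<eta>\<close> make both \<open>3 * \<delta>\<close> and
      \<open>6 * \<eta> / \<delta>\<^sup>2\<close> at most \<open>\<rho> / 2\<close>.\<close>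
    define K M where "K = 4 / \<gamma>" and "M = 23328 / \<gamma>"
    define \<rho> where "\<rho> = min (\<gamma> / M) (\<epsilon> * \<gamma> / (4 * (23328 * K)))"
    define \<delta> where "\<delta> = min (\<rho> / 6) 1"
    define \<eta> where "\<eta> = \<rho> * \<delta>\<^sup>2 / 12"
    have "K > 0" "M > 0" using \<open>\<gamma> > 0\<close> by (simp_all add: K_def M_def)
    moreover from this have "\<rho> > 0" using \<open>\<gamma> > 0\<close> \<open>\<epsilon> > 0\<close> by (simp add: \<rho>_def)
    moreover from this have "\<delta> > 0" by (simp add: \<delta>_def)
    ultimately have pos: "K > 0" "M > 0" "\<rho> > 0" "\<delta> > 0" "\<eta> > 0"
      by (simp_all add: \<eta>_def)
    have \<rho>: "\<rho> * M \<le> \<gamma>" "23328 * K * \<rho> / \<epsilon> \<le> \<gamma> / 4"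
    proof -
      have "\<rho> \<le> \<gamma> / M" by (simp add: \<rho>_def)
      then show "\<rho> * M \<le> \<gamma>" using pos by (simp add: pos_le_divide_eq)
      have "\<rho> \<le> \<epsilon> * \<gamma> / (4 * (23328 * K))" unfolding \<rho>_def by (rule min.cobounded2)
      then have "\<rho> * (4 * (23328 * K)) \<le> \<epsilon> * \<gamma>" using pos by (subst (asm) pos_le_divide_eq) auto
      then show "23328 * K * \<rho> / \<epsilon> \<le> \<gamma> / 4" using \<open>\<epsilon> > 0\<close> by (simp add: field_simps)
    qed
    have \<delta>: "\<delta> \<le> 1" "3 * \<delta> \<le> \<rho> / 2" by (auto simp: \<delta>_def)
    \<comment> \<open>The bound 4 gives \<open>n \<le> 2 * (n - 2)\<close>, hence
      \<open>n * p\<^sup>2 \<le> 1\<close>; \<open>2 / \<delta>\<close> is for subcriticality; the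
      last bound together with \<open>d \<le> 1 / 2\<close> forces
      \<open>p n \<le> \<eta>\<close>.\<close>
    have "\<forall>\<^sub>F n in sequentially. max 4 (max (2 / \<delta>) (2 + 1 / (2 * \<eta>\<^sup>2))) \<le> real n"
      using filterlim_real_sequentially by (simp only: filterlim_at_top)
    then show ?thesis
    proof eventually_elim
      case (elim n)
      then have n: "4 \<le> real n" "2 / \<delta> \<le> real n" "2 + 1 / (2 * \<eta>\<^sup>2) \<le> real n" by auto
      define L where "L = real n ^ 3 * p n ^ 3"
      have p: "0 \<le> p n" using assms(1)[of n] by auto
      have "1 / (2 * \<eta>\<^sup>2) * (p n)\<^sup>2 \<le> (real n - 2) * (p n)\<^sup>2"
        using n(3) by (intro mult_right_mono) auto
      also have "\<dots> \<le> 1 / 2" by (rule assms(2))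
      finally have "(p n)\<^sup>2 \<le> \<eta>\<^sup>2" using pos by (simp add: field_simps)
      then have "p n \<le> \<eta>" using pos power2_le_imp_le[of "p n" \<eta>] by auto
      then have "6 * p n / \<delta>\<^sup>2 \<le> 6 * \<eta> / \<delta>\<^sup>2" by (intro divide_right_mono) auto
      also have "\<dots> = \<rho> / 2" using pos by (simp add: \<eta>_def)
      finally have "(3 * \<delta> + 6 * p n / \<delta>\<^sup>2) * L \<le> \<rho> * L"
        using p \<delta> by (intro mult_right_mono) (auto simp: L_def)
      then have E: "measure_pmf.expectation (gnp n (p n)) (excess_bound n \<delta>) \<le> \<rho> * L"
        using expectation_excess_bound_subcritical[OF assms(1,2), of \<delta> n] pos(4) \<delta>(1) n(2)
        by (simp add: L_def)
      have np: "real n * (p n)\<^sup>2 \<le> 1"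
      proof -
        have "real n * (p n)\<^sup>2 \<le> (2 * (real n - 2)) * (p n)\<^sup>2"
          using n(1) by (intro mult_right_mono) auto
        also have "\<dots> = 2 * ((real n - 2) * (p n)\<^sup>2)" by simp
        finally show ?thesis using assms(2)[of n] by linarith
      qed
      have d: "\<delta> \<in> {0..1}" using pos \<delta> by auto
      show "?P n \<ge> 1 - \<gamma>"
      \<comment> \<open>The sequence \<open>L\<close> need be neither bounded nor divergent, so the
        two regimes are separated for each \<open>n\<close> individually.\<close>
      proof (cases "L \<le> M")
        case True
        then have "\<rho> * L \<le> \<gamma>" using \<rho>(1) pos(3) mult_left_mono[of L M \<rho>] by linarith
        then show ?thesis
          using prob_cover_le_packing_small[OF d \<open>\<epsilon> > 0\<close>] E by force
      next
        case False
        then have L: "L > M" "L > 0" using pos by auto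
        have "5832 / L \<le> 5832 / M" using L pos by (intro divide_left_mono) auto
        also have "\<dots> = \<gamma> / 4" by (simp add: M_def)
        finally have "5832 / L \<le> \<gamma> / 4" .
        moreover have "1 / K = \<gamma> / 4" by (simp add: K_def)
        moreover have "?P n \<ge> 1 - (1 / K + 5832 / L + 23328 * K * \<rho> / \<epsilon>)"
          unfolding L_def
          by (rule prob_cover_le_packing_large[OF assms(1) d \<open>\<epsilon> > 0\<close> pos(1) _ np])
            (use n(1) L(2) E in \<open>auto simp: L_def\<close>)
        ultimately show ?thesis using \<rho>(2) \<open>\<gamma> > 0\<close> by linarith
      qed
    qed
  qed
  show "?P \<longlonglongrightarrow> 1"
  proof (rule tendstoI)
    fix e :: real assume "e > 0"
    then have "\<forall>\<^sub>F n in sequentially. ?P n \<ge> 1 - e / 2" by (intro main) simp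
    then show "\<forall>\<^sub>F n in sequentially. dist (?P n) 1 < e"
    proof eventually_elim
      case (elim n)
      moreover have "?P n \<le> 1" by (rule measure_pmf.prob_le_1)
      ultimately show ?case using \<open>e > 0\<close> unfolding dist_real_def by linarith
    qed
  qed
qed

end
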